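(* Every Valdivia compact space is either scattered or contains a closed uncountable metrizable subspace.
   Context: All topological spaces are assumed to be Tychonoff, so compact spaces are compact Hausdorff. For a set $\Gamma$, $\Sigma(\Gamma)$ denotes the subspace of the product $\mathbb{R}^\Gamma$ consisting of those functions $x:\Gamma\to\mathbb{R}$ whose support $\{\gamma\in\Gamma: x(\gamma)\neq 0\}$ is countable. A compact space $K$ is a Valdivia compact space if, for some set $\Gamma$, there exists an embedding $i:K\to\mathbb{R}^\Gamma$ such that $i(K)\cap\Sigma(\Gamma)$ is dense in $i(K)$. A space $X$ is scattered if no nonempty subset $A\subseteq X$ is dense-in-itself (i.e. every nonempty subspace has an isolated point). *)

theory Defs
  imports "HOL-Analysis.Analysis"
begin

text \<open>The product \<open>\<real>\<^sup>\<Gamma>\<close> is \<^term>\<open>product_topology (\<lambda>_. euclideanreal) \<Gamma>\<close>; its points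
  are the functions in \<^term>\<open>\<Gamma> \<rightarrow>\<^sub>E (UNIV :: real set)\<close>.\<close>

definition Sigma_product :: "'g set \<Rightarrow> ('g \<Rightarrow> real) set" where
  "Sigma_product \<Gamma> = {x \<in> \<Gamma> \<rightarrow>\<^sub>E UNIV. countable {\<gamma> \<in> \<Gamma>. x \<gamma> \<noteq> 0}}"

text \<open>HOL cannot quantify existentially over types, so the type \<open>'g\<close> containing the index set
  \<open>\<Gamma>\<close> is a parameter of the notion. A theorem assuming
  \<open>Valdivia_compact_space TYPE('g) X\<close> with \<open>'g\<close> a type variable covers all index sets.\<close>

definition Valdivia_compact_space :: "'g itself \<Rightarrow> 'a topology \<Rightarrow> bool" where
  "Valdivia_compact_space (_ :: 'g itself) X \<longleftrightarrow>
     compact_space X \<and> Hausdorff_space X \<and>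
     (\<exists>(\<Gamma> :: 'g set) i.
        embedding_map X (product_topology (\<lambda>_. euclideanreal) \<Gamma>) i \<and>
        subtopology (product_topology (\<lambda>_. euclideanreal) \<Gamma>) (i ` topspace X)
          closure_of (i ` topspace X \<inter> Sigma_product \<Gamma>) = i ` topspace X)"

definition dense_in_itself :: "'a topology \<Rightarrow> 'a set \<Rightarrow> bool" where
  "dense_in_itself X A \<longleftrightarrow> A \<subseteq> X derived_set_of A"

definition scattered_space :: "'a topology \<Rightarrow> bool" where
  "scattered_space X \<longleftrightarrow> \<not> (\<exists>A. A \<subseteq> topspace X \<and> A \<noteq> {} \<and> dense_in_itself X A)"

end

theory Submission
  imports Defs
begin

text \<open>
  Let \<open>K \<subseteq> \<real>\<^sup>\<Gamma>\<close> be compact with \<open>K \<inter> \<Sigma>(\<Gamma>)\<close> dense in \<open>K\<close>, and let \<open>Q \<subseteq> K\<close> be nonempty and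
  dense-in-itself. For \<open>A \<subseteq> \<Gamma>\<close> let \<open>r\<^sub>A\<close> replace the coordinates outside \<open>A\<close> by \<open>0\<close>. A closing-off
  argument over the rational boxes gives a countable \<open>A\<close> such that every rational box with
  coordinates in \<open>A\<close> that meets \<open>K\<close> contains a point of \<open>K\<close> supported in \<open>A\<close>, and every such box
  that meets \<open>Q\<close> contains two points of \<open>Q\<close> that differ at a coordinate in \<open>A\<close>. The first
  property makes \<open>r\<^sub>A\<close> a map of \<open>K\<close> into \<open>K\<close>; the second makes \<open>r\<^sub>A(Q)\<close> dense-in-itself. The points
  of \<open>K\<close> supported in \<open>A\<close> therefore form a closed metrizable subspace with a nonempty perfect
  subset, and such a subset is uncountable.
\<close>

section \<open>Cardinality of perfect sets\<close>

text \<open>A set without isolated points has a perfect closure, and a nonempty perfect set in a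
  locally compact Hausdorff space has at least the cardinality of the reals.\<close>

lemma uncountable_closure_of_dense_in_itself:
  assumes "compact_space X" "Hausdorff_space X"
    and "A \<noteq> {}" and A: "A \<subseteq> X derived_set_of A"
  shows "uncountable (X closure_of A)"
proof -
  have eq: "X closure_of A = X derived_set_of A"
    using A derived_set_of_subset_topspace[of X A] by (auto simp: closure_of_alt)
  have "A \<subseteq> X closure_of A"
    using A eq by simp
  moreover have "X derived_set_of (X closure_of A) = X closure_of A"
  proof
    show "X derived_set_of (X closure_of A) \<subseteq> X closure_of A"
      by (metis closedin_closure_of closure_of_subset_topspace derived_set_subset)
    show "X closure_of A \<subseteq> X derived_set_of (X closure_of A)"
      using derived_set_of_mono[OF \<open>A \<subseteq> X closure_of A\<close>] eq by auto
  qed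
  ultimately have "(UNIV::real set) \<lesssim> X closure_of A"
    using assms compact_imp_locally_compact_space lepoll_perfect_set
    by (metis subset_empty)
  then show ?thesis
    using countable_lepoll uncountable_UNIV_real by blast
qed

section \<open>Closing off under countable-valued operations\<close>

text \<open>A countable set has only countably many finite lists over it with labels in
  \<open>'b\<close>, so adding all \<open>h l\<close> keeps it countable. After \<omega> rounds
  nothing is missing, because a list is finite and already lies in some round.\<close>

lemma countable_closing_off:
  fixes h :: "('g \<times> 'b::countable) list \<Rightarrow> 'g set"
  assumes "\<And>l. countable (h l)"
  obtains A where "countable A" "\<And>l. set l \<subseteq> A \<times> UNIV \<Longrightarrow> h l \<subseteq> A"
proof -
  define F where "F B = B \<union> (\<Union>l \<in> lists (B \<times> UNIV). h l)" for B
  \<comment> \<open>Starting from the empty set is enough: the empty list is a list over it and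
    contributes \<open>h []\<close> in the first round.\<close>
  define A where "A = (\<Union>n. (F ^^ n) {})"
  have "countable ((F ^^ n) {})" for n
    by (induction n) (auto simp: F_def assms intro!: countable_UN countable_lists)
  then have "countable A"
    by (auto simp: A_def)
  moreover have "h l \<subseteq> A" if l: "set l \<subseteq> A \<times> UNIV" for l
  proof -
    have mono: "incseq (\<lambda>n. (F ^^ n) {})"
      by (rule incseq_SucI) (auto simp: F_def)
    have "\<exists>n. set l \<subseteq> (F ^^ n) {} \<times> UNIV"
      using l
    proof (induction l)
      case (Cons p l)
      then obtain n m where n: "set l \<subseteq> (F ^^ n) {} \<times> UNIV" and m: "fst p \<in> (F ^^ m) {}"
        by (auto simp: A_def)
      have "(F ^^ n) {} \<subseteq> (F ^^ max n m) {}" "(F ^^ m) {} \<subseteq> (F ^^ max n m) {}"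
        using mono by (auto simp: incseq_def)
      then have "set (p # l) \<subseteq> (F ^^ max n m) {} \<times> UNIV"
        using n m by (cases p) auto
      then show ?case by blast
    qed auto
    then obtain n where "set l \<subseteq> (F ^^ n) {} \<times> UNIV"
      by blast
    then have "h l \<subseteq> (F ^^ Suc n) {}"
      by (auto simp: F_def lists_eq_set)
    then show ?thesis
      by (auto simp: A_def simp del: funpow.simps)
  qed
  ultimately show thesis
    using that by blast
qed

section \<open>Basic open boxes with rational sides\<close>

text \<open>A list encodes finitely many constraints, which fits the closing-off lemma with
  \<open>'b = rat \<times> rat\<close>. Nothing is required outside the listed coordinates, not even
  extensionality, so openness is stated after intersecting with the product.\<close>

definition rational_box :: "('g \<times> rat \<times> rat) list \<Rightarrow> ('g \<Rightarrow> real) set" where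
  "rational_box l = {x. \<forall>(\<gamma>, a, b) \<in> set l. of_rat a < x \<gamma> \<and> x \<gamma> < of_rat b}"

lemma openin_rational_box:
  assumes "set l \<subseteq> \<Gamma> \<times> UNIV"
  shows "openin (powertop_real \<Gamma>) ((\<Gamma> \<rightarrow>\<^sub>E UNIV) \<inter> rational_box l)"
  using assms
proof (induction l)
  case Nil
  then show ?case
    using openin_topspace[of "powertop_real \<Gamma>"] by (simp add: rational_box_def)
next
  case (Cons p l)
  obtain \<gamma> a b where p: "p = (\<gamma>, a, b)" "\<gamma> \<in> \<Gamma>"
    using Cons.prems by (cases p) auto
  have "openin (powertop_real \<Gamma>)
      {x \<in> topspace (powertop_real \<Gamma>). x \<gamma> \<in> {of_rat a<..<of_rat b}}"
    by (rule openin_continuous_map_preimage[OF continuous_map_product_coordinates])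
       (use p in auto)
  moreover have "(\<Gamma> \<rightarrow>\<^sub>E UNIV) \<inter> rational_box (p # l) =
      {x \<in> topspace (powertop_real \<Gamma>). x \<gamma> \<in> {of_rat a<..<of_rat b}}
        \<inter> ((\<Gamma> \<rightarrow>\<^sub>E UNIV) \<inter> rational_box l)"
    by (auto simp: rational_box_def p)
  ultimately show ?case
    using Cons by auto
qed

lemma rational_box_meets_of_closure:
  assumes "set l \<subseteq> \<Gamma> \<times> UNIV" "x \<in> powertop_real \<Gamma> closure_of Y" "x \<in> rational_box l"
  shows "\<exists>y\<in>Y. y \<in> rational_box l"
proof -
  have "x \<in> topspace (powertop_real \<Gamma>)"
    using assms(2) by (simp only: in_closure_of)
  then have "x \<in> (\<Gamma> \<rightarrow>\<^sub>E UNIV) \<inter> rational_box l"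
    using assms(3) by simp
  then show ?thesis
    using assms(2) openin_rational_box[OF assms(1)] unfolding in_closure_of by blast
qed

lemma rational_box_meets_of_derived_set:
  assumes "set l \<subseteq> \<Gamma> \<times> UNIV" "x \<in> powertop_real \<Gamma> derived_set_of Y" "x \<in> rational_box l"
  shows "\<exists>y\<in>Y. y \<noteq> x \<and> y \<in> rational_box l"
proof -
  have "x \<in> topspace (powertop_real \<Gamma>)"
    using assms(2) by (simp only: in_derived_set_of)
  then have "x \<in> (\<Gamma> \<rightarrow>\<^sub>E UNIV) \<inter> rational_box l"
    using assms(3) by simp
  then show ?thesis
    using assms(2) openin_rational_box[OF assms(1)] unfolding in_derived_set_of by blast
qed

text \<open>The boxes form a base: a basic open set of the product restricts only finitely many
  coordinates, and at each of them a rational interval fits around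
  \<open>x \<gamma>\<close>.\<close>

lemma rational_box_neighbourhood:
  assumes "openin (powertop_real \<Gamma>) W" "x \<in> W"
  obtains l where "set l \<subseteq> \<Gamma> \<times> UNIV" "x \<in> rational_box l"
    "(\<Gamma> \<rightarrow>\<^sub>E UNIV) \<inter> rational_box l \<subseteq> W"
proof -
  obtain U where fin: "finite {\<gamma> \<in> \<Gamma>. U \<gamma> \<noteq> UNIV}" and op: "\<And>\<gamma>. \<gamma> \<in> \<Gamma> \<Longrightarrow> open (U \<gamma>)"
    and x: "x \<in> Pi\<^sub>E \<Gamma> U" and W: "Pi\<^sub>E \<Gamma> U \<subseteq> W"
    using assms by (force simp: openin_product_topology_alt)
  have "\<exists>a b. of_rat a < x \<gamma> \<and> x \<gamma> < of_rat b \<and> {of_rat a<..<of_rat b} \<subseteq> U \<gamma>"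
    if \<gamma>: "\<gamma> \<in> \<Gamma>" for \<gamma>
  proof -
    obtain e where e: "e > 0" "ball (x \<gamma>) e \<subseteq> U \<gamma>"
      using op[of \<gamma>] PiE_mem[OF x \<gamma>] \<gamma> open_contains_ball[of "U \<gamma>"] by blast
    obtain a b where "x \<gamma> - e < of_rat a" "of_rat a < x \<gamma>" "x \<gamma> < of_rat b" "of_rat b < x \<gamma> + e"
      using of_rat_dense[of "x \<gamma> - e" "x \<gamma>"] of_rat_dense[of "x \<gamma>" "x \<gamma> + e"] e by auto
    moreover from this have "{of_rat a<..<of_rat b} \<subseteq> ball (x \<gamma>) e"
      by (auto simp: dist_real_def)
    ultimately show ?thesis
      using e by blast
  qed
  then obtain a b where ab: "\<And>\<gamma>. \<gamma> \<in> \<Gamma> \<Longrightarrow> of_rat (a \<gamma>) < x \<gamma> \<and> x \<gamma> < of_rat (b \<gamma>) \<and>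
      {of_rat (a \<gamma>)<..<of_rat (b \<gamma>)} \<subseteq> U \<gamma>"
    by metis
  obtain l0 where l0: "set l0 = {\<gamma> \<in> \<Gamma>. U \<gamma> \<noteq> UNIV}"
    using fin finite_list by blast
  define l where "l = map (\<lambda>\<gamma>. (\<gamma>, a \<gamma>, b \<gamma>)) l0"
  have "y \<in> Pi\<^sub>E \<Gamma> U" if y: "y \<in> (\<Gamma> \<rightarrow>\<^sub>E UNIV) \<inter> rational_box l" for y
  proof -
    have "y \<gamma> \<in> U \<gamma>" if "\<gamma> \<in> \<Gamma>" for \<gamma>
    proof (cases "U \<gamma> = UNIV")
      case False
      then have "y \<gamma> \<in> {of_rat (a \<gamma>)<..<of_rat (b \<gamma>)}"
        using y that by (auto simp: rational_box_def l_def l0)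
      then show ?thesis
        using ab[OF that] by blast
    qed simp
    then show ?thesis
      using y by (auto simp: PiE_iff)
  qed
  then have "(\<Gamma> \<rightarrow>\<^sub>E UNIV) \<inter> rational_box l \<subseteq> W"
    using W by blast
  moreover have "set l \<subseteq> \<Gamma> \<times> UNIV" "x \<in> rational_box l"
    using ab by (auto simp: l_def l0 rational_box_def)
  ultimately show thesis
    using that by blast
qed

section \<open>Restriction to a set of coordinates\<close>

text \<open>This is the map \<open>r_A\<close> of the introduction; the restricted abstraction makes
  its values extensional on \<open>\<Gamma>\<close>, hence points of the product.\<close>

definition zero_outside :: "'g set \<Rightarrow> 'g set \<Rightarrow> ('g \<Rightarrow> real) \<Rightarrow> 'g \<Rightarrow> real" where
  "zero_outside \<Gamma> A x = (\<lambda>\<gamma>\<in>\<Gamma>. if \<gamma> \<in> A then x \<gamma> else 0)"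

lemma zero_outside_in_PiE: "zero_outside \<Gamma> A x \<in> \<Gamma> \<rightarrow>\<^sub>E UNIV"
  by (simp add: zero_outside_def)

text \<open>The constraints of a box at coordinates outside \<open>A\<close> can be dropped, because all points
  supported in \<open>A\<close> take the same value \<open>0\<close> there.\<close>

lemma zero_outside_neighbourhood:
  assumes "openin (powertop_real \<Gamma>) W" "zero_outside \<Gamma> A x \<in> W"
  obtains l where "set l \<subseteq> (\<Gamma> \<inter> A) \<times> UNIV" "x \<in> rational_box l"
    "\<And>y. y \<in> rational_box l \<Longrightarrow> zero_outside \<Gamma> A y \<in> W"
proof -
  obtain l where l: "set l \<subseteq> \<Gamma> \<times> UNIV" "zero_outside \<Gamma> A x \<in> rational_box l"
    "(\<Gamma> \<rightarrow>\<^sub>E UNIV) \<inter> rational_box l \<subseteq> W"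
    using rational_box_neighbourhood[OF assms] .
  define l' where "l' = filter (\<lambda>p. fst p \<in> A) l"
  have x_box: "y \<in> rational_box l'" if "zero_outside \<Gamma> A y \<in> rational_box l" for y
    using that l(1) by (fastforce simp: rational_box_def l'_def zero_outside_def)
  have "zero_outside \<Gamma> A y \<in> rational_box l" if y: "y \<in> rational_box l'" for y
    unfolding rational_box_def
  proof (clarify)
    fix \<gamma> a b assume p: "(\<gamma>, a, b) \<in> set l"
    then have "\<gamma> \<in> \<Gamma>" using l(1) by auto
    show "of_rat a < zero_outside \<Gamma> A y \<gamma> \<and> zero_outside \<Gamma> A y \<gamma> < of_rat b"
    proof (cases "\<gamma> \<in> A")
      case True
      then show ?thesis
        using p y \<open>\<gamma> \<in> \<Gamma>\<close> by (force simp: rational_box_def l'_def zero_outside_def)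
    next
      case False
      then have "zero_outside \<Gamma> A y \<gamma> = zero_outside \<Gamma> A x \<gamma>"
        using \<open>\<gamma> \<in> \<Gamma>\<close> by (simp add: zero_outside_def)
      then show ?thesis
        using p l(2) by (auto simp: rational_box_def)
    qed
  qed
  then have W: "zero_outside \<Gamma> A y \<in> W" if "y \<in> rational_box l'" for y
    using subsetD[OF l(3) IntI[OF zero_outside_in_PiE]] that by simp
  have "set l' \<subseteq> (\<Gamma> \<inter> A) \<times> UNIV"
    using l(1) by (auto simp: l'_def)
  then show thesis
    using that[OF _ x_box[OF l(2)] W] by simp
qed

text \<open>The subspace is itself a product of metrizable factors, and only the countably many
  factors with index in \<open>A\<close> have more than one point.\<close>

lemma metrizable_countably_supported:
  assumes "countable A"
  shows "metrizable_space (subtopology (powertop_real \<Gamma>)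
    (\<Pi>\<^sub>E \<gamma>\<in>\<Gamma>. if \<gamma> \<in> A then UNIV else {0}))"
proof -
  have "countable {\<gamma> \<in> \<Gamma>. \<not> (\<exists>a. topspace (subtopology euclideanreal
      (if \<gamma> \<in> A then UNIV else {0})) \<subseteq> {a})}"
    by (rule countable_subset[OF _ assms]) auto
  then show ?thesis
    by (auto simp: subtopology_product_topology metrizable_space_product_topology
        intro!: metrizable_space_subtopology metrizable_space_euclidean)
qed

section \<open>Construction inside the product\<close>

lemma exists_uncountable_metrizable_in_product:
  fixes \<Gamma> :: "'g set"
  defines "T \<equiv> powertop_real \<Gamma>"
  assumes K: "compactin T K" and dense: "K \<subseteq> T closure_of (K \<inter> Sigma_product \<Gamma>)"
    and Q: "Q \<subseteq> K" "Q \<noteq> {}" "Q \<subseteq> T derived_set_of Q"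
  obtains S where "S \<subseteq> K" "closedin T S" "uncountable S" "metrizable_space (subtopology T S)"
proof -
  have T: "Hausdorff_space T"
    by (simp add: T_def Hausdorff_space_product_topology)
  have KT: "K \<subseteq> \<Gamma> \<rightarrow>\<^sub>E UNIV"
    using compactin_subset_topspace[OF K] by (simp add: T_def)
  have "\<exists>B. countable B \<and> (\<exists>y\<in>K. y \<in> rational_box l \<and> {\<gamma> \<in> \<Gamma>. y \<gamma> \<noteq> 0} \<subseteq> B)"
    if l: "set l \<subseteq> \<Gamma> \<times> UNIV" and x: "x \<in> K" "x \<in> rational_box l" for l x
  proof -
    have "x \<in> T closure_of (K \<inter> Sigma_product \<Gamma>)"
      using dense x(1) by blast
    then obtain y where y: "y \<in> K" "y \<in> Sigma_product \<Gamma>" "y \<in> rational_box l"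
      using rational_box_meets_of_closure[OF l _ x(2)] by (auto simp: T_def)
    then have "countable {\<gamma> \<in> \<Gamma>. y \<gamma> \<noteq> 0}"
      by (simp add: Sigma_product_def)
    with y show ?thesis
      by blast
  qed
  \<comment> \<open>For a list that is not over \<open>\<Gamma>\<close>, or whose box misses
    \<open>K\<close>, the empty set serves as \<open>B\<close>; this makes the choice function
    total.\<close>
  then have "\<forall>l. \<exists>B. countable B \<and> (set l \<subseteq> \<Gamma> \<times> UNIV \<longrightarrow> K \<inter> rational_box l \<noteq> {} \<longrightarrow>
      (\<exists>y\<in>K. y \<in> rational_box l \<and> {\<gamma> \<in> \<Gamma>. y \<gamma> \<noteq> 0} \<subseteq> B))"
    by (meson countable_empty disjoint_iff)
  from choice[OF this] obtain f where "\<forall>l. countable (f l) \<and>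
      (set l \<subseteq> \<Gamma> \<times> UNIV \<longrightarrow> K \<inter> rational_box l \<noteq> {} \<longrightarrow>
        (\<exists>y\<in>K. y \<in> rational_box l \<and> {\<gamma> \<in> \<Gamma>. y \<gamma> \<noteq> 0} \<subseteq> f l))" ..
  then have f: "countable (f l)"
    "set l \<subseteq> \<Gamma> \<times> UNIV \<Longrightarrow> K \<inter> rational_box l \<noteq> {} \<Longrightarrow>
      \<exists>y\<in>K. y \<in> rational_box l \<and> {\<gamma> \<in> \<Gamma>. y \<gamma> \<noteq> 0} \<subseteq> f l" for l
    by simp_all
  \<comment> \<open>As \<open>u\<close> is not isolated in \<open>Q\<close>, its box contains a
    second point of \<open>Q\<close>; two distinct points of the product differ at a coordinate in
    \<open>\<Gamma>\<close>.\<close>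
  have "\<exists>\<gamma>\<in>\<Gamma>. \<exists>u\<in>Q. \<exists>v\<in>Q. u \<in> rational_box l \<and> v \<in> rational_box l \<and> u \<gamma> \<noteq> v \<gamma>"
    if l: "set l \<subseteq> \<Gamma> \<times> UNIV" and u: "u \<in> Q" "u \<in> rational_box l" for l u
  proof -
    have "u \<in> T derived_set_of Q"
      using Q(3) u(1) by blast
    then obtain v where v: "v \<in> Q" "v \<in> rational_box l" "v \<noteq> u"
      using rational_box_meets_of_derived_set[OF l _ u(2)] by (auto simp: T_def)
    then have "u \<in> \<Gamma> \<rightarrow>\<^sub>E UNIV" "v \<in> \<Gamma> \<rightarrow>\<^sub>E UNIV"
      using u(1) Q(1) KT by blast+
    then have "\<exists>\<gamma>\<in>\<Gamma>. u \<gamma> \<noteq> v \<gamma>"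
      using v(3) PiE_ext[of u \<Gamma> "\<lambda>_. UNIV" v] by blast
    then show ?thesis
      using u v by blast
  qed
  then have "\<forall>l. \<exists>\<gamma>. set l \<subseteq> \<Gamma> \<times> UNIV \<longrightarrow> Q \<inter> rational_box l \<noteq> {} \<longrightarrow>
      \<gamma> \<in> \<Gamma> \<and> (\<exists>u\<in>Q. \<exists>v\<in>Q. u \<in> rational_box l \<and> v \<in> rational_box l \<and> u \<gamma> \<noteq> v \<gamma>)"
    by (meson disjoint_iff)
  from choice[OF this] obtain g where g: "\<forall>l. set l \<subseteq> \<Gamma> \<times> UNIV \<longrightarrow> Q \<inter> rational_box l \<noteq> {} \<longrightarrow>
      g l \<in> \<Gamma> \<and> (\<exists>u\<in>Q. \<exists>v\<in>Q. u \<in> rational_box l \<and> v \<in> rational_box l \<and> u (g l) \<noteq> v (g l))" ..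
  obtain A where A: "countable A"
    and cl: "\<And>l. set l \<subseteq> A \<times> UNIV \<Longrightarrow> insert (g l) (f l) \<subseteq> A"
    by (rule countable_closing_off[of "\<lambda>l. insert (g l) (f l)"]) (use f(1) in auto)
  \<comment> \<open>\<open>f\<close> and \<open>g\<close> are controlled only on lists over
    \<open>\<Gamma>\<close>, and \<open>A\<close> may contain indices outside
    \<open>\<Gamma>\<close>. Hence the boxes used from here on have coordinates in
    \<open>\<Gamma> \<inter> A\<close>.\<close>
  have hA: "f l \<subseteq> A" "g l \<in> A" "set l \<subseteq> \<Gamma> \<times> UNIV" if "set l \<subseteq> (\<Gamma> \<inter> A) \<times> UNIV" for l
  proof -
    have "set l \<subseteq> A \<times> UNIV" using that by auto
    then show "f l \<subseteq> A" "g l \<in> A" using cl by auto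
    show "set l \<subseteq> \<Gamma> \<times> UNIV" using that by auto
  qed
  define r where "r = zero_outside \<Gamma> A"
  \<comment> \<open>\<open>P\<close> is the image of the retraction \<open>r\<close>, consisting of
    the points of the product that vanish on \<open>\<Gamma> - A\<close>.\<close>
  define P where "P = (\<Pi>\<^sub>E \<gamma>\<in>\<Gamma>. if \<gamma> \<in> A then UNIV else {0::real})"
  define S where "S = K \<inter> P"
  have rP: "r x \<in> P" for x
    by (auto simp: r_def zero_outside_def P_def)
  have r_id: "r x = x" if "x \<in> P" for x
    using that by (intro PiE_ext[of _ \<Gamma> "\<lambda>_. UNIV"])
      (auto simp: r_def zero_outside_def P_def PiE_iff split: if_splits)
  have nbhd: "\<exists>l. set l \<subseteq> (\<Gamma> \<inter> A) \<times> UNIV \<and> x \<in> rational_box l \<and>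
      (\<forall>y\<in>rational_box l. r y \<in> W)" if "openin T W" "r x \<in> W" for W x
    using zero_outside_neighbourhood[of \<Gamma> W A x] that unfolding T_def r_def by metis
  have rK: "r x \<in> K" if x: "x \<in> K" for x
  proof -
    \<comment> \<open>A neighbourhood of \<open>r x\<close> pulls back to a box around
      \<open>x\<close> over \<open>\<Gamma> \<inter> A\<close>. This box meets \<open>K\<close> in
      some \<open>y\<close> supported in \<open>f l \<subseteq> A\<close>, and
      \<open>y = r y\<close> lies in \<open>W\<close>. So \<open>r x\<close> is in the closure of
      the closed set \<open>K\<close>.\<close>
    have "\<exists>y\<in>K. y \<in> W" if W: "openin T W" "r x \<in> W" for W
    proof -
      obtain l where l: "set l \<subseteq> (\<Gamma> \<inter> A) \<times> UNIV" "x \<in> rational_box l"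
        "\<forall>y\<in>rational_box l. r y \<in> W"
        using nbhd[OF W] by blast
      then obtain y where y: "y \<in> K" "y \<in> rational_box l" "{\<gamma> \<in> \<Gamma>. y \<gamma> \<noteq> 0} \<subseteq> f l"
        using f(2)[OF hA(3)[OF l(1)]] x by blast
      then have "y \<in> P"
        using hA(1)[OF l(1)] KT by (auto simp: P_def PiE_iff)
      then show ?thesis
        using y l(3) r_id by metis
    qed
    moreover have "r x \<in> topspace T"
      by (simp add: T_def r_def zero_outside_in_PiE del: PiE_iff)
    ultimately have "r x \<in> T closure_of K"
      unfolding in_closure_of by blast
    then show ?thesis
      using closure_of_closedin compactin_imp_closedin[OF T K] by metis
  qed
  have "closedin T P"
    by (auto simp: T_def P_def closedin_product_topology)
  then have S: "closedin T S" "compactin T S"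
    using K compactin_imp_closedin[OF T K] by (auto simp: S_def compact_Int_closedin)
  have dense_image: "r ` Q \<subseteq> T derived_set_of (r ` Q)"
  proof (clarify, unfold in_derived_set_of, intro conjI allI impI)
    fix x assume x: "x \<in> Q"
    show "r x \<in> topspace T"
      by (simp add: T_def r_def zero_outside_in_PiE)
    fix W assume W: "r x \<in> W \<and> openin T W"
    then obtain l where l: "set l \<subseteq> (\<Gamma> \<inter> A) \<times> UNIV" "x \<in> rational_box l"
      "\<forall>y\<in>rational_box l. r y \<in> W"
      using nbhd by blast
    then have "Q \<inter> rational_box l \<noteq> {}"
      using x by blast
    then obtain u v where uv: "u \<in> Q" "v \<in> Q" "u \<in> rational_box l" "v \<in> rational_box l"
      and "g l \<in> \<Gamma>" "u (g l) \<noteq> v (g l)"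
      using g[rule_format, OF hA(3)[OF l(1)]] by blast
    \<comment> \<open>Since \<open>g l\<close> is in \<open>A\<close>, the map \<open>r\<close>
      keeps \<open>u\<close> and \<open>v\<close> apart. Their images cannot both equal
      \<open>r x\<close>, so one of them is the required other point of \<open>W\<close>.\<close>
    then have "r u (g l) \<noteq> r v (g l)"
      using hA(2)[OF l(1)] by (simp add: r_def zero_outside_def)
    then have "r u \<noteq> r x \<or> r v \<noteq> r x"
      by auto
    then show "\<exists>y. y \<noteq> r x \<and> y \<in> r ` Q \<and> y \<in> W"
      using uv l(3) by blast
  qed
  have rQ: "r ` Q \<subseteq> S"
    using rP rK Q(1) by (auto simp: S_def)
  have "uncountable (subtopology T S closure_of (r ` Q))"
  proof (rule uncountable_closure_of_dense_in_itself)
    show "compact_space (subtopology T S)"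
      using S(2) by (simp add: compact_space_subtopology)
    show "Hausdorff_space (subtopology T S)"
      using T by (rule Hausdorff_space_subtopology)
    show "r ` Q \<noteq> {}"
      using Q(2) by simp
    show "r ` Q \<subseteq> subtopology T S derived_set_of (r ` Q)"
      using dense_image rQ by (simp add: derived_set_of_subtopology Int_absorb1)
  qed
  moreover have "subtopology T S closure_of (r ` Q) \<subseteq> S"
    by (metis closure_of_subset_topspace inf.boundedE topspace_subtopology)
  ultimately have "uncountable S"
    using countable_subset by blast
  moreover have "metrizable_space (subtopology T S)"
  proof -
    \<comment> \<open>Metrizability is inherited from the larger subspace \<open>P\<close>.\<close>
    have "subtopology T S = subtopology (subtopology T P) S"
      by (simp add: subtopology_subtopology S_def Int_ac)
    then show ?thesis
      using metrizable_space_subtopology[OF metrizable_countably_supported[OF A, of \<Gamma>]]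
      by (simp add: T_def P_def)
  qed
  ultimately show thesis
    using that S(1) by (auto simp: S_def)
qed

section \<open>Transfer along the embedding\<close>

theorem proposition4p4:
  fixes X :: "'a topology"
  assumes "Valdivia_compact_space TYPE('g) X"
  shows "scattered_space X \<or>
    (\<exists>S. closedin X S \<and> uncountable S \<and> metrizable_space (subtopology X S))"
proof (cases "scattered_space X")
  case False
  then obtain D where D: "D \<subseteq> topspace X" "D \<noteq> {}" "D \<subseteq> X derived_set_of D"
    unfolding scattered_space_def dense_in_itself_def by blast
  obtain \<Gamma> :: "'g set" and i where X: "compact_space X"
    and i: "embedding_map X (powertop_real \<Gamma>) i"
    and dense: "subtopology (powertop_real \<Gamma>) (i ` topspace X)
          closure_of (i ` topspace X \<inter> Sigma_product \<Gamma>) = i ` topspace X"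
    using assms unfolding Valdivia_compact_space_def by blast
  define T where "T = powertop_real \<Gamma>"
  define K where "K = i ` topspace X"
  have hom: "homeomorphic_map X (subtopology T K) i"
    using i by (simp add: embedding_map_def T_def K_def)
  have K: "compactin T K"
    using image_compactin[of X "topspace X" T i] X homeomorphic_imp_continuous_map[OF hom]
    by (simp add: K_def compact_space_def continuous_map_in_subtopology)
  have K_dense: "K \<subseteq> T closure_of (K \<inter> Sigma_product \<Gamma>)"
    using dense closure_of_subtopology_subset[of T K "K \<inter> Sigma_product \<Gamma>"]
    by (simp add: T_def K_def)
  \<comment> \<open>A homeomorphism onto \<open>K\<close> preserves limit points, and limit points
    within \<open>K\<close> are limit points in the whole product.\<close>
  have "i ` D \<subseteq> subtopology T K derived_set_of (i ` D)"
    using homeomorphic_map_derived_set_of[OF hom D(1)] D(3) by auto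
  moreover have iD: "i ` D \<subseteq> K" "i ` D \<noteq> {}"
    using D by (auto simp: K_def)
  ultimately have "i ` D \<subseteq> T derived_set_of (i ` D)"
    by (simp add: derived_set_of_subtopology Int_absorb1)
  with iD obtain S where S: "S \<subseteq> K" "closedin T S" "uncountable S"
    "metrizable_space (subtopology T S)"
    using exists_uncountable_metrizable_in_product[of \<Gamma> K "i ` D"] K K_dense
    unfolding T_def by blast
  \<comment> \<open>Because \<open>S \<subseteq> K\<close>, the map \<open>i\<close> restricts to a
    homeomorphism from this preimage onto \<open>S\<close>, so all three properties of
    \<open>S\<close> pull back to \<open>X\<close>.\<close>
  define S' where "S' = {x \<in> topspace X. i x \<in> S}"
  have iS': "i ` S' = S"
    using S(1) by (auto simp: S'_def K_def)
  have "closedin (subtopology T K) S"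
    using S(1,2) by (simp add: closedin_subset_topspace)
  then have "closedin X S'"
    unfolding S'_def
    using closedin_continuous_map_preimage homeomorphic_imp_continuous_map[OF hom] by blast
  moreover have "uncountable S'"
    using S(3) iS' by blast
  moreover have "metrizable_space (subtopology X S')"
  proof -
    have "homeomorphic_map (subtopology X S') (subtopology (subtopology T K) S) i"
      using hom by (rule homeomorphic_map_subtopologies)
        (use iS' S(1) closedin_subset[OF S(2)] in \<open>auto simp: S'_def K_def\<close>)
    moreover have "subtopology (subtopology T K) S = subtopology T S"
      using S(1) by (simp add: subtopology_subtopology Int_absorb1)
    ultimately show ?thesis
      using S(4) homeomorphic_map_imp_homeomorphic_space homeomorphic_metrizable_space by metis
  qed
  ultimately show ?thesis
    by blast
qed simp

end
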